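(* Let $f\in\mathcal{A}$ and let $A=e^{-2i\alpha}$ with $\alpha\in\mathbb{R}$, $|\alpha|<\pi/2$. If $$\frac{1+zf''(z)/f'(z)}{zf'(z)/f(z)}\prec 1+\frac{(1+A)z}{(1+Az)^2}\quad\text{for } z\in\mathbb{D},$$ then $f\in\mathcal{SP}(\alpha)$.
   Context: Let $\mathbb{D}=\{z\in\mathbb{C}:|z|<1\}$ and let $\mathcal{A}$ be the family of analytic functions $f$ in $\mathbb{D}$ with $f(0)=0$, $f'(0)=1$. For analytic functions $f,g$ in $\mathbb{D}$, $f\prec g$ ($f$ is subordinate to $g$) means that there is an analytic $\omega:\mathbb{D}\to\mathbb{D}$ with $\omega(0)=0$ and $f(z)=g(\omega(z))$ for $z\in\mathbb{D}$. The class $\mathcal{SP}(\alpha)$ of $\alpha$-spiral functions consists of all $f\in\mathcal{A}$ with $\operatorname{Re}\left(e^{i\alpha}\frac{zf'(z)}{f(z)}\right)>0$ for $z\in\mathbb{D}$. *)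

theory Defs
  imports "HOL-Complex_Analysis.Complex_Analysis"
begin

definition class_A :: "(complex \<Rightarrow> complex) set" where
  "class_A = {f. f holomorphic_on ball 0 1 \<and> f 0 = 0 \<and> deriv f 0 = 1}"

definition subordinate :: "(complex \<Rightarrow> complex) \<Rightarrow> (complex \<Rightarrow> complex) \<Rightarrow> bool" where
  "subordinate f g \<longleftrightarrow>
     f holomorphic_on ball 0 1 \<and> g holomorphic_on ball 0 1 \<and>
     (\<exists>\<omega>. \<omega> holomorphic_on ball 0 1 \<and> \<omega> ` ball 0 1 \<subseteq> ball 0 1 \<and> \<omega> 0 = 0 \<and>
          (\<forall>z\<in>ball 0 1. f z = g (\<omega> z)))"

text \<open>
  The quotients below are meromorphic in the disc and are formally undefined at \<open>z = 0\<close>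
  (and at zeros of \<open>f\<close> and \<open>f'\<close>), where total division in HOL would give a meaningless value.
  As usual, they are understood after filling in removable singularities: \<open>remove_sings\<close>
  takes the limit wherever it exists, so for \<open>f\<close> in the class above both functions have the
  value \<open>1\<close> at \<open>0\<close>. At a genuine pole it returns \<open>0\<close>. This is harmless: in \<open>SP\<close> the strict
  inequality fails there, and a function with such a point is not holomorphic, hence not
  subordinate to anything.
\<close>

definition zf'_over_f :: "(complex \<Rightarrow> complex) \<Rightarrow> complex \<Rightarrow> complex" where
  "zf'_over_f f = remove_sings (\<lambda>z. z * deriv f z / f z)"

definition convex_starlike_quotient :: "(complex \<Rightarrow> complex) \<Rightarrow> complex \<Rightarrow> complex" where
  "convex_starlike_quotient f =
     remove_sings (\<lambda>z. (1 + z * deriv (deriv f) z / deriv f z) / (z * deriv f z / f z))"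

definition SP :: "real \<Rightarrow> (complex \<Rightarrow> complex) set" where
  "SP \<alpha> = {f \<in> class_A. \<forall>z\<in>ball 0 1. Re (exp (\<i> * of_real \<alpha>) * zf'_over_f f z) > 0}"

end

theory Submission
  imports Defs
begin

text \<open>
  Put \<open>p = zf'/f\<close> and \<open>u = 1/p\<close>. Differentiating logarithmically,
  \<open>(1 + zf''/f') / p = 1 + zp'/p\<^sup>2 = 1 - zu'\<close>, so the hypothesis prescribes the values of the
  Euler derivative \<open>zu'\<close>. Let \<open>c = exp(i\<alpha>)\<close>, so that \<open>A = 1/c\<^sup>2\<close>, and let \<open>g = u/c\<close>; then \<open>cp = 1/g\<close>,
  and the assertion becomes \<open>Re g > 0\<close>. Because \<open>c + 1/c = 2 cos \<alpha>\<close>, the hypothesis turns into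
  \<open>zg'(z) = 2 cos \<alpha> K(\<zeta>)\<close> with \<open>\<zeta> = -A\<omega>(z)\<close> in the unit disc and the Koebe function
  \<open>K(\<zeta>) = \<zeta>/(1-\<zeta>)\<^sup>2\<close>, whose image of the disc avoids the ray \<open>(-\<infinity>, -1/4]\<close>. Hence \<open>zg'\<close> avoids
  the ray \<open>(-\<infinity>, -\<rho>/2]\<close>, where \<open>\<rho> = Re g(0) = cos \<alpha> > 0\<close>.

  If \<open>Re g\<close> were not positive throughout, there would be a point \<open>z\<^sub>0\<close> of least modulus with
  \<open>Re g(z\<^sub>0) \<le> 0\<close>. Since \<open>Re g\<close> is positive in the smaller disc, \<open>Re g\<close> cannot decrease in any
  inward direction, which makes \<open>z\<^sub>0g'(z\<^sub>0)\<close> real; and Harnack's inequality makes the inward slope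
  so large that \<open>z\<^sub>0g'(z\<^sub>0) \<le> -\<rho>/2\<close>. So \<open>z\<^sub>0g'(z\<^sub>0)\<close> lies on the forbidden ray
  (\<open>Re_pos_if_Euler_derivative_omits_ray\<close>). This is the Miller-Mocanu principle
  of differential subordination, in the one case at hand.

  The zeros of \<open>f\<close> and \<open>f'\<close> could be poles of \<open>p\<close> and \<open>u\<close>. To avoid discussing them, \<open>u\<close> is not
  defined as a quotient: it is the holomorphic solution \<open>U\<close> of \<open>zU' = 1 - Q\<close>, \<open>U(0) = 1\<close>, where
  \<open>Q\<close> is the given holomorphic quotient. Near \<open>0\<close> the identity \<open>f = zUf'\<close> can be verified directly,
  and analytic continuation spreads it over the disc (\<open>class_A_factorization\<close>). The argument above
  applies to \<open>U\<close> and shows in particular that \<open>U\<close> has no zeros; then \<open>zf'/f = 1/U\<close> off the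
  isolated zeros of \<open>f\<close>, so that every singularity of \<open>zf'/f\<close> is removable.
\<close>

section \<open>Functions with positive real part\<close>

text \<open>
  The Cayley transform of the right half-plane that sends \<open>g 0\<close> to \<open>0\<close> turns \<open>g\<close> into a function
  to which the Schwarz lemma applies.
\<close>
lemma Harnack_half_plane:
  fixes g :: "complex \<Rightarrow> complex"
  assumes hol: "g holomorphic_on ball 0 r" and r: "r > 0"
    and pos: "\<And>z. norm z < r \<Longrightarrow> Re (g z) > 0"
    and z: "norm z < r"
  shows "Re (g z) \<ge> Re (g 0) * (r - norm z) / (r + norm z)"
proof -
  define a where "a = g 0"
  define \<phi> where "\<phi> = (\<lambda>w. (g (of_real r * w) - a) / (g (of_real r * w) + cnj a))"
  have a: "Re a > 0" using pos[of 0] r by (simp add: a_def)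
  have in_ball: "norm (of_real r * w) < r" if "norm w < 1" for w :: complex
    using that r by (simp add: norm_mult)
  have den: "g (of_real r * w) + cnj a \<noteq> 0" if "norm w < 1" for w
    using pos[OF in_ball[OF that]] a by (auto simp: complex_eq_iff)
  \<comment> \<open>Points with \<open>Re w > 0\<close> are closer to \<open>a\<close> than to its mirror image \<open>- cnj a\<close>.\<close>
  have dist: "(norm (w + cnj a))\<^sup>2 - (norm (w - a))\<^sup>2 = 4 * Re w * Re a" for w
    unfolding cmod_power2 by (simp add: power2_eq_square algebra_simps)
  have "(\<lambda>w. g (of_real r * w)) holomorphic_on ball 0 1"
    by (rule holomorphic_on_compose_gen[OF _ hol, unfolded o_def])
       (use in_ball in \<open>auto intro!: holomorphic_intros\<close>)
  then have hol\<phi>: "\<phi> holomorphic_on ball 0 1"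
    unfolding \<phi>_def by (intro holomorphic_intros) (auto simp: den)
  have \<phi>0: "\<phi> 0 = 0" by (simp add: \<phi>_def a_def)
  have \<phi>1: "norm (\<phi> w) < 1" if "norm w < 1" for w
  proof -
    have "4 * Re (g (of_real r * w)) * Re a > 0"
      using pos[OF in_ball[OF that]] a by simp
    then have "(norm (g (of_real r * w) - a))\<^sup>2 < (norm (g (of_real r * w) + cnj a))\<^sup>2"
      using dist[of "g (of_real r * w)"] by linarith
    then have "norm (g (of_real r * w) - a) < norm (g (of_real r * w) + cnj a)"
      using power2_less_imp_less norm_ge_zero by blast
    then show ?thesis using den[OF that] by (simp add: \<phi>_def norm_divide)
  qed
  define t where "t = norm z / r"
  have t: "0 \<le> t" "t < 1" using z r by (auto simp: t_def)
  define N where "N = norm (g z + cnj a)"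
  have "norm (z / of_real r) = t" using r by (simp add: t_def norm_divide)
  then have "norm (\<phi> (z / of_real r)) \<le> t"
    using Schwarz_Lemma(1)[OF hol\<phi> \<phi>0 \<phi>1, of "z / of_real r"] t by simp
  moreover have zr: "of_real r * (z / of_real r) = z" using r by simp
  moreover have Npos: "N > 0"
    using den[of "z / of_real r"] zr \<open>norm (z / of_real r) = t\<close> t by (simp add: N_def)
  ultimately have le: "norm (g z - a) \<le> t * N"
    by (simp add: \<phi>_def norm_divide N_def field_simps)
  have "2 * Re a = norm ((g z + cnj a) - (g z - a))"
    using a by (simp add: complex_add_cnj add.commute norm_mult flip: of_real_mult)
  also have "\<dots> \<le> N + t * N"
    using norm_triangle_ineq4[of "g z + cnj a" "g z - a"] le by (simp add: N_def)
  finally have N: "2 * Re a \<le> (1 + t) * N" by (simp add: algebra_simps)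
  have "(2 * Re a)\<^sup>2 * (1 - t) \<le> ((1 + t) * N)\<^sup>2 * (1 - t)"
    using N a t by (intro mult_right_mono power_mono) auto
  also have "\<dots> = (1 + t) * (N\<^sup>2 - (t * N)\<^sup>2)"
    by (simp add: power2_eq_square algebra_simps)
  also have "\<dots> \<le> (1 + t) * (N\<^sup>2 - (norm (g z - a))\<^sup>2)"
    using le t by (intro mult_left_mono diff_left_mono power_mono) auto
  also have "\<dots> = (1 + t) * (4 * Re (g z) * Re a)"
    using dist[of "g z"] by (simp add: N_def)
  finally have "(4 * Re a) * (Re a * (1 - t)) \<le> (4 * Re a) * ((1 + t) * Re (g z))"
    by (simp add: power2_eq_square algebra_simps)
  then have *: "Re a * (1 - t) \<le> (1 + t) * Re (g z)"
    using a by (subst (asm) mult_le_cancel_left_pos) auto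
  have "Re a * (r - norm z) / (r + norm z) = Re a * (1 - t) / (1 + t)"
  proof -
    have "r - norm z = r * (1 - t)" "r + norm z = r * (1 + t)"
      using r by (simp_all add: t_def algebra_simps)
    then show ?thesis using r by simp
  qed
  also have "\<dots> \<le> Re (g z)" using * t by (simp add: field_simps)
  finally show ?thesis by (simp add: a_def)
qed

text \<open>
  At a first point \<open>z0\<close> where \<open>Re g\<close> fails to be positive, \<open>Re g\<close> is minimal over the closed disc
  of radius \<open>norm z0\<close>. Its tangential derivative there vanishes, and by Harnack's inequality
  its radial derivative is at most \<open>- Re (g 0) / (2 * norm z0)\<close>; both together place
  \<open>z0 * deriv g z0\<close> on the omitted ray.
\<close>
lemma Re_pos_if_Euler_derivative_omits_ray:
  fixes g :: "complex \<Rightarrow> complex"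
  assumes hol: "g holomorphic_on ball 0 1" and g0: "Re (g 0) > 0"
    and omits: "\<And>z. norm z < 1 \<Longrightarrow> Im (z * deriv g z) = 0 \<Longrightarrow> Re (z * deriv g z) > - Re (g 0) / 2"
    and z: "norm z < 1"
  shows "Re (g z) > 0"
proof (rule ccontr)
  assume neg: "\<not> Re (g z) > 0"
  define K where "K = cball 0 (norm z) \<inter> (\<lambda>w. Re (g w)) -` {..0}"
  have "continuous_on (cball 0 (norm z)) g"
    using z by (intro holomorphic_on_imp_continuous_on holomorphic_on_subset[OF hol]) auto
  then have "closed K" unfolding K_def
    by (intro continuous_closed_preimage continuous_intros) auto
  then have "compact K"
    unfolding K_def by (metis compact_cball compact_Int_closed Int_left_absorb)
  moreover have "z \<in> K" using neg by (simp add: K_def)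
  ultimately obtain z0 where z0: "z0 \<in> K" and min: "\<And>w. w \<in> K \<Longrightarrow> norm z0 \<le> norm w"
    using continuous_attains_inf[of K norm] continuous_on_norm_id by blast
  have z01: "norm z0 < 1" and Rez0: "Re (g z0) \<le> 0"
    using z0 z by (auto simp: K_def)
  have pos: "Re (g w) > 0" if "norm w < norm z0" for w
    using min[of w] that z0 by (force simp: K_def)
  have z0_nz: "norm z0 > 0" using g0 Rez0 by auto
  define L where "L = z0 * deriv g z0"
  have deriv_along: "((\<lambda>t. Re (g (z0 * (1 + of_real t * e)))) has_real_derivative Re (L * e)) (at 0)"
    for e
  proof -
    have "(g has_field_derivative deriv g z0) (at (z0 * (1 + of_real 0 * e)))"
      using holomorphic_derivI[OF hol, of z0] z01 by simp
    moreover have "((\<lambda>t::real. z0 * (1 + of_real t * e)) has_vector_derivative z0 * e) (at 0)"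
      by (auto intro!: derivative_eq_intros simp: has_vector_derivative_def scaleR_conv_of_real)
    ultimately have "((\<lambda>t. g (z0 * (1 + of_real t * e))) has_vector_derivative z0 * e * deriv g z0) (at 0)"
      using field_vector_diff_chain_at[of "\<lambda>t::real. z0 * (1 + of_real t * e)" _ 0 g "deriv g z0"]
      by (simp add: o_def)
    then show ?thesis
      unfolding has_real_derivative_iff_has_vector_derivative
      by (drule_tac bounded_linear.has_vector_derivative[OF bounded_linear_Re])
         (simp add: L_def mult_ac)
  qed
  \<comment> \<open>A direction \<open>z0 * e\<close> with \<open>Re e < 0\<close> leads into the smaller disc, where \<open>Re g > 0\<close>.\<close>
  have inward: "Re (L * e) \<ge> 0" if e: "Re e < 0" for e
  proof (rule ccontr)
    assume "\<not> Re (L * e) \<ge> 0"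
    then obtain d where d: "d > 0"
      "\<And>h. 0 < h \<Longrightarrow> h < d \<Longrightarrow> Re (g (z0 * (1 + of_real h * e))) < Re (g z0)"
      using DERIV_neg_dec_right[OF deriv_along[of e]] by force
    have e0: "norm e > 0" using e by auto
    define h where "h = min (d / 2) (- Re e / (norm e)\<^sup>2)"
    have h: "0 < h" "h < d" "h \<le> - Re e / (norm e)\<^sup>2"
      using d(1) e e0 by (auto simp: h_def min_def divide_neg_pos field_simps)
    then have "h * (norm e)\<^sup>2 \<le> - Re e"
      using e0 by (simp add: field_simps)
    then have "h * (h * (norm e)\<^sup>2) \<le> h * (- Re e)"
      using h by (intro mult_left_mono) auto
    then have "(norm (1 + of_real h * e))\<^sup>2 \<le> 1 + h * Re e"
      unfolding cmod_power2 by (simp add: power2_eq_square algebra_simps)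
    also have "\<dots> < 1" using h e by (simp add: mult_pos_neg)
    finally have "norm (1 + of_real h * e) < 1"
      by (simp add: power_less_one_iff abs_square_less_1)
    then have "Re (g (z0 * (1 + of_real h * e))) > 0"
      using z0_nz by (intro pos) (simp add: norm_mult)
    with d(2)[OF h(1,2)] Rez0 show False by simp
  qed
  have "Im L = 0"
  proof (rule ccontr)
    assume "Im L \<noteq> 0"
    \<comment> \<open>Directions that are almost tangential see only \<open>Im L\<close>; with this one, \<open>Re (L * e) = -1\<close>.\<close>
    then show False
      using inward[of "Complex (-1) ((1 - Re L) / Im L)"] by simp
  qed
  moreover have "Re L \<le> - Re (g 0) / 2"
  proof (rule ccontr)
    assume "\<not> Re L \<le> - Re (g 0) / 2"
    \<comment> \<open>Harnack's inequality gives \<open>Re (g ((1 - t) * z0)) \<ge> Re (g 0) * t / 2\<close>; subtracting this linear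
      bound leaves a function that cannot drop below its value at \<open>t = 0\<close>.\<close>
    then have neg: "Re (L * (-1)) - Re (g 0) / 2 < 0" by simp
    have "((\<lambda>t. Re (g (z0 * (1 + of_real t * (-1)))) - Re (g 0) / 2 * t)
       has_real_derivative Re (L * (-1)) - Re (g 0) / 2) (at 0)"
      using DERIV_diff[OF deriv_along[of "-1"] DERIV_cmult_Id[of "Re (g 0) / 2"]] by simp
    from DERIV_neg_dec_right[OF this neg] obtain d where d: "d > 0"
      "\<And>h. 0 < h \<Longrightarrow> h < d \<Longrightarrow>
         Re (g (z0 * (1 + of_real h * (-1)))) - Re (g 0) / 2 * h < Re (g z0)"
      by auto
    define h where "h = min (d / 2) (1 / 2)"
    have h: "0 < h" "h < d" "h < 1" using d(1) by (auto simp: h_def)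
    have nz: "norm (z0 * (1 - of_real h)) = norm z0 * (1 - h)"
    proof -
      have "z0 * (1 - of_real h) = z0 * of_real (1 - h)" by simp
      then show ?thesis using h by (simp only: norm_mult norm_of_real)
    qed
    have "g holomorphic_on ball 0 (norm z0)"
      using z01 by (intro holomorphic_on_subset[OF hol]) auto
    then have "Re (g (z0 * (1 - of_real h))) \<ge>
        Re (g 0) * (norm z0 - norm z0 * (1 - h)) / (norm z0 + norm z0 * (1 - h))"
      using Harnack_half_plane[of g "norm z0" "z0 * (1 - of_real h)"] pos z0_nz h
      by (simp add: nz)
    also have "Re (g 0) * (norm z0 - norm z0 * (1 - h)) / (norm z0 + norm z0 * (1 - h))
        = Re (g 0) * (h / (2 - h))"
    proof -
      have "norm z0 - norm z0 * (1 - h) = norm z0 * h"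
        "norm z0 + norm z0 * (1 - h) = norm z0 * (2 - h)"
        by (auto simp: algebra_simps)
      then show ?thesis using z0_nz by simp
    qed
    finally have "Re (g (z0 * (1 - of_real h))) \<ge> Re (g 0) * (h / (2 - h))" .
    moreover have "Re (g 0) * (h / (2 - h)) \<ge> Re (g 0) * (h / 2)"
      using g0 h by (intro mult_left_mono divide_left_mono) auto
    moreover have "Re (g (z0 * (1 - of_real h))) < Re (g 0) * (h / 2)"
      using d(2)[OF h(1,2)] Rez0 by simp
    ultimately show False by linarith
  qed
  ultimately show False using omits[OF z01] by (simp add: L_def)
qed

text \<open>
  If the Koebe function takes a nonzero real value \<open>k\<close> at \<open>\<zeta>\<close>, then \<open>\<zeta>\<close> is a root of the real
  polynomial \<open>X\<^sup>2 - s X + 1\<close> with \<open>s = 2 + 1 / k\<close>. For \<open>k \<le> - 1 / 4\<close> the coefficient \<open>s\<close> lies in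
  \<open>[-2, 2]\<close>, and then both roots lie on the unit circle.
\<close>
lemma Koebe_function_omits_ray:
  fixes \<zeta> :: complex
  assumes "norm \<zeta> < 1" and "\<zeta> / (1 - \<zeta>)\<^sup>2 = of_real k"
  shows "k > - 1 / 4"
proof (rule ccontr)
  assume "\<not> k > - 1 / 4"
  then have k: "k \<le> - 1 / 4" by simp
  have ne: "1 - \<zeta> \<noteq> 0" using assms(1) by auto
  define s where "s = 2 + 1 / k"
  have s: "-2 \<le> s" "s \<le> 2" using k by (auto simp: s_def field_simps)
  have "\<zeta> = of_real k * (1 - \<zeta>)\<^sup>2" using assms(2) ne by (simp add: field_simps)
  moreover have "k * s = 2 * k + 1" using k by (simp add: s_def field_simps)
  then have "of_real k * (of_real s :: complex) = 2 * of_real k + 1"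
    by (metis of_real_1 of_real_add of_real_mult of_real_numeral)
  ultimately have "of_real k * (\<zeta>\<^sup>2 - of_real s * \<zeta> + 1) = 0"
    by algebra
  then have eq: "\<zeta>\<^sup>2 - of_real s * \<zeta> + 1 = 0" using k by auto
  define x y where "x = Re \<zeta>" and "y = Im \<zeta>"
  have re: "x\<^sup>2 - y\<^sup>2 - s * x + 1 = 0" and im: "2 * x * y - s * y = 0"
    using arg_cong[OF eq, of Re] arg_cong[OF eq, of Im]
    by (simp_all add: x_def y_def power2_eq_square)
  have lt: "x\<^sup>2 + y\<^sup>2 < 1"
    using assms(1) by (simp add: x_def y_def cmod_def)
  show False
  proof (cases "y = 0")
    case True
    have "\<bar>x\<bar> < 1" using lt True by (simp add: abs_square_less_1)
    then have "(1 - \<bar>x\<bar>)\<^sup>2 > 0" by simp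
    moreover have "s * x \<le> 2 * \<bar>x\<bar>"
      using mult_right_mono[of "\<bar>s\<bar>" 2 "\<bar>x\<bar>"] s abs_ge_self[of "s * x"]
      by (simp add: abs_mult abs_le_iff)
    ultimately show False using re True by (simp add: power2_eq_square algebra_simps)
  next
    case False
    then have "s = 2 * x" using im by simp
    then have "x\<^sup>2 + y\<^sup>2 = 1" using re by (simp add: power2_eq_square algebra_simps)
    then show False using lt by simp
  qed
qed

section \<open>The Euler operator at the origin\<close>

text \<open>
  The solutions of \<open>z E' = E\<close> are the multiples of the identity, since \<open>E z / z\<close> has derivative \<open>0\<close>;
  the condition at \<open>0\<close> says that the factor is \<open>0\<close>.
\<close>
lemma Euler_equation_trivial:
  fixes E :: "complex \<Rightarrow> complex"
  assumes hol: "E holomorphic_on S" and S: "open S" "connected S" "0 \<in> S"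
    and eq: "\<And>z. z \<in> S \<Longrightarrow> z * deriv E z = E z" and E0: "deriv E 0 = 0"
    and z: "z \<in> S"
  shows "E z = 0"
proof -
  define F where "F = (\<lambda>z. if z = 0 then deriv E 0 else (E z - E 0) / (z - 0))"
  have "F holomorphic_on S"
    unfolding F_def by (rule pole_lemma[OF hol]) (use S in \<open>simp add: interior_open\<close>)
  then have "continuous_on S F" by (rule holomorphic_on_imp_continuous_on)
  have E00: "E 0 = 0" using eq[OF S(3)] by simp
  have "DERIV F w :> 0" if w: "w \<in> S - {0}" for w
  proof (rule has_field_derivative_transform_within_open)
    have "((\<lambda>v. E v / v) has_field_derivative (deriv E w * w - E w * 1) / (w * w)) (at w)"
      using w holomorphic_derivI[OF hol S(1), of w] by (intro DERIV_divide) auto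
    then show "((\<lambda>v. E v / v) has_field_derivative 0) (at w)"
      using eq[of w] w by (simp add: mult.commute)
    show "open (S - {0})" using S by auto
  qed (use w E00 in \<open>auto simp: F_def\<close>)
  then obtain c where c: "\<And>w. w \<in> S \<Longrightarrow> F w = c"
    using DERIV_zero_connected_constant[of S "{0}" F] S \<open>continuous_on S F\<close> by blast
  then have "F z = 0" using c[OF S(3)] c[OF z] E0 by (simp add: F_def)
  then show ?thesis using E00 by (auto simp: F_def split: if_splits)
qed

lemma Euler_primitive:
  fixes P :: "complex \<Rightarrow> complex"
  assumes hol: "P holomorphic_on S" and S: "open S" "convex S" "0 \<in> S" and P0: "P 0 = 0"
  obtains U where "U holomorphic_on S" "U 0 = c" "\<And>z. z \<in> S \<Longrightarrow> z * deriv U z = P z"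
proof -
  define F where "F = (\<lambda>z. if z = 0 then deriv P 0 else (P z - P 0) / (z - 0))"
  have "F holomorphic_on S"
    unfolding F_def by (rule pole_lemma[OF hol]) (use S in \<open>simp add: interior_open\<close>)
  then obtain G where G: "\<And>z. z \<in> S \<Longrightarrow> (G has_field_derivative F z) (at z within S)"
    using holomorphic_convex_primitive'[OF S(2,1)] by blast
  define U where "U = (\<lambda>z. G z - G 0 + c)"
  have D: "(U has_field_derivative F z) (at z)" if "z \<in> S" for z
  proof -
    have "(G has_field_derivative F z) (at z)"
      using G[OF that] by (simp add: at_within_open[OF that S(1)])
    then have "((\<lambda>z. G z - G 0 + c) has_field_derivative F z - 0 + 0) (at z)"
      by (intro DERIV_add DERIV_diff DERIV_const)
    then show ?thesis by (simp add: U_def)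
  qed
  show ?thesis
  proof
    show "U holomorphic_on S"
      using D S(1) by (auto simp: holomorphic_on_open)
    show "U 0 = c" by (simp add: U_def)
    show "z * deriv U z = P z" if "z \<in> S" for z
      using DERIV_imp_deriv[OF D[OF that]] P0 by (simp add: F_def)
  qed
qed

section \<open>The logarithmic derivative of a normalized function\<close>

lemma class_A_not_identically_zero:
  assumes "f \<in> class_A"
  obtains \<beta> where "\<beta> \<in> ball 0 1" "f \<beta> \<noteq> 0"
proof -
  have holf: "f holomorphic_on ball 0 1" and df0: "deriv f 0 = 1"
    using assms by (auto simp: class_A_def)
  have "\<exists>\<beta>\<in>ball 0 1. f \<beta> \<noteq> 0"
  proof (rule ccontr)
    assume "\<not> ?thesis"
    then have "deriv f 0 = deriv (\<lambda>_. 0) 0"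
      by (intro complex_derivative_transform_within_open[of _ "ball 0 1"] holf) auto
    then show False using df0 by simp
  qed
  then show ?thesis using that by blast
qed

text \<open>
  Formally \<open>U = f / (z f')\<close>. Near \<open>0\<close>, where \<open>f'\<close> has no zeros, the assumption on \<open>U\<close> says that
  both \<open>f / f'\<close> and \<open>z U\<close> solve \<open>z V' = V + z (1 - Q)\<close>; their difference \<open>E\<close> then solves the
  homogeneous equation \<open>z E' = E\<close> with \<open>E'(0) = 0\<close>. Stated without division, the conclusion can be
  continued analytically past the zeros of \<open>f'\<close>.
\<close>
lemma class_A_factorization:
  assumes f: "f \<in> class_A" and hol: "U holomorphic_on ball 0 1" and U0: "U 0 = 1"
    and U: "\<And>z. z \<in> ball 0 1 \<Longrightarrow> z * deriv U z = 1 - convex_starlike_quotient f z"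
    and z: "z \<in> ball 0 1"
  shows "f z = z * U z * deriv f z"
proof -
  have holf: "f holomorphic_on ball 0 1" and f0: "f 0 = 0" and df0: "deriv f 0 = 1"
    using f by (auto simp: class_A_def)
  have holdf: "deriv f holomorphic_on ball 0 1"
    by (intro holomorphic_deriv holf) auto
  define Q where "Q = convex_starlike_quotient f"
  obtain \<beta> where \<beta>: "\<beta> \<in> ball 0 1" "f \<beta> \<noteq> 0" by (rule class_A_not_identically_zero[OF f])
  obtain r1 where r1: "r1 > 0" "ball 0 r1 \<subseteq> ball (0 :: complex) 1"
    "\<And>w. w \<in> ball 0 r1 - {0} \<Longrightarrow> f w \<noteq> 0"
    by (rule isolated_zeros[OF holf open_ball connected_ball _ f0 \<beta>]) (simp, rule that)
  have "isCont (deriv f) 0"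
    using holomorphic_on_imp_continuous_on[OF holdf] by (simp add: continuous_on_eq_continuous_at)
  then obtain r2 where r2: "r2 > 0" "\<And>w. dist 0 w < r2 \<Longrightarrow> deriv f w \<noteq> 0"
    using continuous_at_avoid[of 0 "deriv f" 0] df0 by auto
  define B where "B = ball (0 :: complex) (min r1 r2)"
  have B: "B \<subseteq> ball 0 1" "open B" "connected B" "0 \<in> B"
    and nz: "\<And>w. w \<in> B - {0} \<Longrightarrow> f w \<noteq> 0" "\<And>w. w \<in> B \<Longrightarrow> deriv f w \<noteq> 0"
    using r1 r2 by (auto simp: B_def)
  \<comment> \<open>The factor \<open>w\<close> makes the formula hold at \<open>w = 0\<close> too, where the raw quotient is meaningless.\<close>
  have Q: "w * Q w = w * ((1 + w * deriv (deriv f) w / deriv f w) / (w * deriv f w / f w))"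
    if w: "w \<in> B" for w
  proof (cases "w = 0")
    case False
    have "(\<lambda>w. (1 + w * deriv (deriv f) w / deriv f w) / (w * deriv f w / f w))
            holomorphic_on (B - {0})"
      using B nz
      by (intro holomorphic_intros holomorphic_deriv holomorphic_on_subset[OF holf]) auto
    then have "(\<lambda>w. (1 + w * deriv (deriv f) w / deriv f w) / (w * deriv f w / f w)) analytic_on {w}"
      using w False B by (intro holomorphic_on_imp_analytic_at[of _ "B - {0}"]) auto
    then show ?thesis
      by (simp add: Q_def convex_starlike_quotient_def)
  qed simp
  define E where "E = (\<lambda>w. f w / deriv f w - w * U w)"
  have holE: "E holomorphic_on B"
    unfolding E_def using B nz
    by (intro holomorphic_intros holomorphic_on_subset[OF holf] holomorphic_on_subset[OF holdf]
          holomorphic_on_subset[OF hol]) auto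
  have dE: "deriv E w = 1 - f w * deriv (deriv f) w / (deriv f w)\<^sup>2 - U w - w * deriv U w"
    if w: "w \<in> B" for w
  proof (rule DERIV_imp_deriv)
    have "w \<in> ball 0 1" using w B by auto
    then have "(f has_field_derivative deriv f w) (at w)"
      "(deriv f has_field_derivative deriv (deriv f) w) (at w)"
      "(U has_field_derivative deriv U w) (at w)"
      by (auto intro: holomorphic_derivI[OF holf] holomorphic_derivI[OF holdf] holomorphic_derivI[OF hol])
    then show "(E has_field_derivative
        1 - f w * deriv (deriv f) w / (deriv f w)\<^sup>2 - U w - w * deriv U w) (at w)"
      unfolding E_def using nz(2)[OF w]
      by (auto intro!: derivative_eq_intros simp: field_simps power2_eq_square)
  qed
  have E0: "E w = 0" if w: "w \<in> B" for w
  proof (rule Euler_equation_trivial[OF holE B(2-4) _ _ w])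
    show "deriv E 0 = 0" using dE[OF B(4)] f0 U0 by simp
    fix v assume v: "v \<in> B"
    have "v * deriv U v = 1 - Q v"
      using U v B by (auto simp: Q_def)
    then have "v * (v * deriv U v) = v - v * Q v"
      by (simp only: right_diff_distrib mult_1_right)
    also have "\<dots> = v - (f v / deriv f v + v * f v * deriv (deriv f) v / (deriv f v)\<^sup>2)"
      unfolding Q[OF v] using nz[of v] v f0
      by (cases "v = 0") (auto simp: field_simps power2_eq_square)
    finally show "v * deriv E v = E v"
      unfolding dE[OF v] by (simp add: E_def algebra_simps)
  qed
  have "f w = w * U w * deriv f w" if "w \<in> B" for w
    using nz(2)[OF that] E0[OF that] by (simp add: E_def nonzero_divide_eq_eq)
  moreover have "(\<lambda>w. w * U w * deriv f w) holomorphic_on ball 0 1"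
    by (intro holomorphic_intros hol holdf)
  ultimately show ?thesis
    using analytic_continuation_open[of B "ball 0 1" f "\<lambda>w. w * U w * deriv f w" z] B holf z
    by auto
qed

text \<open>
  The zeros of \<open>f\<close> are isolated, and everywhere else \<open>f = z U f'\<close> can be solved for \<open>z f' / f\<close>. So
  \<open>1 / U\<close> fills in all singularities of \<open>z f' / f\<close>, including the one at \<open>0\<close>.
\<close>
lemma remove_sings_log_derivative:
  assumes f: "f \<in> class_A" and hol: "U holomorphic_on ball 0 1"
    and fac: "\<And>z. z \<in> ball 0 1 \<Longrightarrow> f z = z * U z * deriv f z"
    and nz: "\<And>z. z \<in> ball 0 1 \<Longrightarrow> U z \<noteq> 0" and z: "z \<in> ball 0 1"
  shows "zf'_over_f f z = 1 / U z"
  unfolding zf'_over_f_def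
proof (rule remove_sings_eqI)
  have holf: "f holomorphic_on ball 0 1"
    using f by (simp add: class_A_def)
  obtain \<beta> where "\<beta> \<in> ball 0 1" "f \<beta> \<noteq> 0" by (rule class_A_not_identically_zero[OF f])
  then have "\<forall>\<^sub>F w in at z. f w \<noteq> 0 \<and> w \<in> ball 0 1"
    using non_zero_neighbour_alt[OF holf _ _ z] by auto
  then have ev: "\<forall>\<^sub>F w in at z. 1 / U w = w * deriv f w / f w"
  proof eventually_elim
    case (elim w)
    with fac[of w] nz[of w] show ?case by (auto simp: field_simps)
  qed
  have "(\<lambda>w. 1 / U w) holomorphic_on ball 0 1"
    using hol nz by (intro holomorphic_intros) auto
  then have "isCont (\<lambda>w. 1 / U w) z"
    using holomorphic_on_imp_continuous_on z by (force simp: continuous_on_eq_continuous_at)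
  then show "(\<lambda>w. w * deriv f w / f w) \<midarrow>z\<rightarrow> 1 / U z"
    by (intro Lim_transform_eventually[OF _ ev] isContD)
qed

section \<open>The subordination criterion for spiral functions\<close>

theorem theorem3p1:
  fixes f :: "complex \<Rightarrow> complex" and \<alpha> :: real and A :: complex
  assumes "f \<in> class_A"
    and "\<bar>\<alpha>\<bar> < pi / 2"
    and "A = exp (- 2 * \<i> * of_real \<alpha>)"
    and "subordinate (convex_starlike_quotient f) (\<lambda>z. 1 + (1 + A) * z / (1 + A * z)\<^sup>2)"
  shows "f \<in> SP \<alpha>"
proof -
  note f = assms(1)
  define Q where "Q = convex_starlike_quotient f"
  obtain \<omega> where \<omega>: "\<omega> ` ball 0 1 \<subseteq> ball 0 1" "\<omega> 0 = 0"
    and Q: "\<And>z. z \<in> ball 0 1 \<Longrightarrow> Q z = 1 + (1 + A) * \<omega> z / (1 + A * \<omega> z)\<^sup>2"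
    and holQ: "Q holomorphic_on ball 0 1"
    using assms(4) unfolding subordinate_def Q_def by (elim conjE exE) auto
  have "(\<lambda>z. 1 - Q z) holomorphic_on ball 0 1"
    using holQ by (intro holomorphic_intros)
  moreover have "1 - Q 0 = 0" using Q[of 0] \<omega> by simp
  ultimately obtain U where U: "U holomorphic_on ball 0 1" "U 0 = 1"
    "\<And>z. z \<in> ball 0 1 \<Longrightarrow> z * deriv U z = 1 - Q z"
    using Euler_primitive[of "\<lambda>z. 1 - Q z" "ball 0 1" 1] by auto
  define c where "c = exp (\<i> * of_real \<alpha>)"
  have c_cis: "c = cis \<alpha>" by (simp add: c_def cis_conv_exp)
  have c: "c \<noteq> 0" "norm c = 1" "cnj c = 1 / c" "A = 1 / c\<^sup>2"
  proof -
    show "c \<noteq> 0" by (simp add: c_def)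
    show "norm c = 1" by (simp add: c_cis)
    show "cnj c = 1 / c" by (simp add: c_cis cis_cnj divide_inverse)
    have "c\<^sup>2 = exp (2 * \<i> * of_real \<alpha>)"
      by (simp add: c_def mult.assoc flip: exp_double)
    then show "A = 1 / c\<^sup>2"
      using exp_minus[of "2 * \<i> * of_real \<alpha>"] by (simp add: assms(3) divide_inverse)
  qed
  have cos: "cos \<alpha> > 0" using assms(2) by (intro cos_gt_zero_pi) auto
  have "c + cnj c = of_real (2 * cos \<alpha>)"
    by (simp add: c_cis complex_add_cnj)
  then have c2: "c + 1 / c = of_real (2 * cos \<alpha>)" by (simp only: c(3))
  \<comment> \<open>Dividing by \<open>c\<close> turns the half-plane of the spiral condition into the right half-plane,
    since \<open>1 / g\<close> will be \<open>c\<close> times the logarithmic derivative of \<open>f\<close>.\<close>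
  define g where "g = (\<lambda>z. U z / c)"
  have holg: "g holomorphic_on ball 0 1"
    unfolding g_def using U(1) c by (intro holomorphic_intros) auto
  have "Re (g 0) = Re (cnj c)" using U(2) c(3) by (simp add: g_def)
  then have g0: "Re (g 0) = cos \<alpha>" by (simp add: c_cis)
  \<comment> \<open>This is the Koebe function at \<open>- A * \<omega> z\<close>, scaled by \<open>2 * Re (g 0)\<close>.\<close>
  have zg: "z * deriv g z = of_real (2 * cos \<alpha>) * (- A * \<omega> z / (1 - (- A * \<omega> z))\<^sup>2)"
    if z: "z \<in> ball 0 1" for z
  proof -
    have "deriv g z = deriv U z / c"
      unfolding g_def using holomorphic_derivI[OF U(1) _ z] c
      by (intro DERIV_imp_deriv) (auto intro!: derivative_eq_intros)
    then have "z * deriv g z = - ((1 + A) / c) * \<omega> z / (1 + A * \<omega> z)\<^sup>2"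
      using U(3)[OF z] Q[OF z] by simp
    also have "(1 + A) / c = A * of_real (2 * cos \<alpha>)"
      unfolding c2[symmetric] using c(1) by (simp add: c(4) field_simps power2_eq_square)
    finally show ?thesis by (simp add: algebra_simps)
  qed
  have Re_g: "Re (g z) > 0" if z: "z \<in> ball 0 1" for z
  proof (rule Re_pos_if_Euler_derivative_omits_ray[OF holg])
    fix w :: complex assume w: "norm w < 1" and real: "Im (w * deriv g w) = 0"
    define \<zeta> where "\<zeta> = - A * \<omega> w"
    have "norm (\<omega> w) < 1" using \<omega>(1) w by (metis image_subset_iff mem_ball_0)
    then have \<zeta>: "norm \<zeta> < 1"
      using c by (simp add: \<zeta>_def norm_mult norm_divide norm_power)
    define L where "L = Re (w * deriv g w)"
    have "w * deriv g w = of_real L" using real by (simp add: L_def complex_eq_iff)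
    then have "of_real (2 * cos \<alpha>) * (\<zeta> / (1 - \<zeta>)\<^sup>2) = of_real L"
      using zg[of w] w by (simp add: \<zeta>_def)
    then have "\<zeta> / (1 - \<zeta>)\<^sup>2 = of_real (L / (2 * cos \<alpha>))"
      using cos by (simp add: field_simps)
    then have "L / (2 * cos \<alpha>) > - 1 / 4" by (rule Koebe_function_omits_ray[OF \<zeta>])
    then show "Re (w * deriv g w) > - Re (g 0) / 2"
      unfolding g0 L_def[symmetric] using cos by (simp add: field_simps)
  qed (use z cos g0 in auto)
  have nz: "U z \<noteq> 0" if "z \<in> ball 0 1" for z
    using Re_g[OF that] by (auto simp: g_def)
  have "Re (c * zf'_over_f f z) > 0" if z: "z \<in> ball 0 1" for z
  proof -
    have fac: "f w = w * U w * deriv f w" if "w \<in> ball 0 1" for w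
      using class_A_factorization[OF f U(1,2) _ that] U(3) by (simp add: Q_def)
    have "c * zf'_over_f f z = inverse (g z)"
      using remove_sings_log_derivative[OF f U(1) fac nz z] c(1) by (simp add: g_def)
    then show ?thesis using Re_g[OF z] by (simp add: sum_power2_gt_zero_iff)
  qed
  then show ?thesis using f by (simp add: SP_def c_def)
qed

end
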